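(* Let $M=2^a$ for some integer $a\geq 2$. For a finite associative $\mathbb{F}_2$-algebra $A$, let $\mu(x^M,A)=\dfrac{|\{y^M : y\in A\}|}{|A|}$, and let $\mathrm{R}(x^M)=\{\mu(x^M,A) : A \text{ is a finite associative } \mathbb{F}_2\text{-algebra}\}\subseteq[0,1]$. Then $\overline{\mathrm{R}(x^M)}=[0,1]$.
   Context: $\mathbb{F}_2$ is the finite field with $2$ elements. Algebras are associative but not assumed commutative. The number $\mu(x^M,A)$ is called the image ratio of the polynomial map $A\to A$, $y\mapsto y^M$, on the finite algebra $A$. The overline denotes topological closure in $[0,1]$ with its usual topology. *)

theory Defs
  imports
    "HOL-Algebra.Module"
    "HOL-Number_Theory.Residues"
    "HOL-Analysis.Elementary_Topology"
begin

(* The library locale algebra requires a commutative multiplication with unit. Here neither is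
   assumed, so the field one of the record A is unconstrained. *)
locale associative_algebra = Module.module R A for R :: "('a, 'm) ring_scheme" (structure)
    and A :: "('a, 'b, 'n) module_scheme" (structure) +
  assumes mult_closed:
      "\<lbrakk>x \<in> carrier A; y \<in> carrier A\<rbrakk> \<Longrightarrow> x \<otimes>\<^bsub>A\<^esub> y \<in> carrier A"
    and mult_assoc:
      "\<lbrakk>x \<in> carrier A; y \<in> carrier A; z \<in> carrier A\<rbrakk> \<Longrightarrow>
        (x \<otimes>\<^bsub>A\<^esub> y) \<otimes>\<^bsub>A\<^esub> z = x \<otimes>\<^bsub>A\<^esub> (y \<otimes>\<^bsub>A\<^esub> z)"
    and mult_l_distr:
      "\<lbrakk>x \<in> carrier A; y \<in> carrier A; z \<in> carrier A\<rbrakk> \<Longrightarrow>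
        (x \<oplus>\<^bsub>A\<^esub> y) \<otimes>\<^bsub>A\<^esub> z = x \<otimes>\<^bsub>A\<^esub> z \<oplus>\<^bsub>A\<^esub> y \<otimes>\<^bsub>A\<^esub> z"
    and mult_r_distr:
      "\<lbrakk>x \<in> carrier A; y \<in> carrier A; z \<in> carrier A\<rbrakk> \<Longrightarrow>
        x \<otimes>\<^bsub>A\<^esub> (y \<oplus>\<^bsub>A\<^esub> z) = x \<otimes>\<^bsub>A\<^esub> y \<oplus>\<^bsub>A\<^esub> x \<otimes>\<^bsub>A\<^esub> z"
    and smult_mult_left:
      "\<lbrakk>c \<in> carrier R; x \<in> carrier A; y \<in> carrier A\<rbrakk> \<Longrightarrow>
        (c \<odot>\<^bsub>A\<^esub> x) \<otimes>\<^bsub>A\<^esub> y = c \<odot>\<^bsub>A\<^esub> (x \<otimes>\<^bsub>A\<^esub> y)"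
    and smult_mult_right:
      "\<lbrakk>c \<in> carrier R; x \<in> carrier A; y \<in> carrier A\<rbrakk> \<Longrightarrow>
        x \<otimes>\<^bsub>A\<^esub> (c \<odot>\<^bsub>A\<^esub> y) = c \<odot>\<^bsub>A\<^esub> (x \<otimes>\<^bsub>A\<^esub> y)"

abbreviation F2 :: "int ring" where
  "F2 \<equiv> residue_ring 2"

definition finite_F2_algebra :: "(int, 'b, 'n) module_scheme \<Rightarrow> bool" where
  "finite_F2_algebra A \<longleftrightarrow> associative_algebra F2 A \<and> finite (carrier A)"

(* The library power y [^] n starts its recursion at the unit, so it is not usable when there is
   none. The following is the n-fold product of y for n > 0; its value at n = 0 is meaningless. *)
definition positive_pow :: "('b, 'n) monoid_scheme \<Rightarrow> 'b \<Rightarrow> nat \<Rightarrow> 'b" where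
  "positive_pow A y n = ((\<lambda>z. z \<otimes>\<^bsub>A\<^esub> y) ^^ (n - 1)) y"

lemma (in monoid) positive_pow_eq_nat_pow:
  assumes "y \<in> carrier G" "n > 0"
  shows "positive_pow G y n = y [^] n"
proof -
  have "((\<lambda>z. z \<otimes> y) ^^ k) y = y [^] Suc k" for k
    using assms(1) by (induction k) auto
  from this[of "n - 1"] assms(2) show ?thesis
    by (simp add: positive_pow_def)
qed

definition image_ratio :: "nat \<Rightarrow> ('b, 'n) monoid_scheme \<Rightarrow> real" where
  "image_ratio M A =
     real (card ((\<lambda>y. positive_pow A y M) ` carrier A)) / real (card (carrier A))"

(* HOL cannot quantify over all carrier types inside a set comprehension. Every finite algebra is
   isomorphic to one with carrier a set of natural numbers, so nothing is lost by using those;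
   see the lemmas image_ratio_in_image_ratios and image_ratio_in_unital_image_ratios. *)
definition image_ratios :: "nat \<Rightarrow> real set" where
  "image_ratios M = {image_ratio M A | A :: (int, nat) module. finite_F2_algebra A}"

definition unital_image_ratios :: "nat \<Rightarrow> real set" where
  "unital_image_ratios M =
     {image_ratio M A | A :: (int, nat) module. finite_F2_algebra A \<and> monoid A}"

definition transport :: "('b \<Rightarrow> 'c) \<Rightarrow> (int, 'b, 'n) module_scheme \<Rightarrow> (int, 'c) module" where
  "transport f A = (let g = inv_into (carrier A) f in
     \<lparr>carrier = f ` carrier A,
      monoid.mult = (\<lambda>x y. f (g x \<otimes>\<^bsub>A\<^esub> g y)),
      one = f \<one>\<^bsub>A\<^esub>,
      zero = f \<zero>\<^bsub>A\<^esub>,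
      add = (\<lambda>x y. f (g x \<oplus>\<^bsub>A\<^esub> g y)),
      smult = (\<lambda>c x. f (c \<odot>\<^bsub>A\<^esub> g x))\<rparr>)"

lemma finite_F2_algebra_transport:
  assumes A: "finite_F2_algebra A" and f: "inj_on f (carrier A)"
  shows "finite_F2_algebra (transport f A)"
proof -
  interpret associative_algebra F2 A
    using A by (simp add: finite_F2_algebra_def)
  note simps = transport_def Let_def inv_into_f_f[OF f]
  have grp: "abelian_group (transport f A)"
  proof (rule abelian_groupI)
    fix x assume "x \<in> carrier (transport f A)"
    then obtain u where u: "u \<in> carrier A" "x = f u"
      by (auto simp: simps)
    show "\<exists>y\<in>carrier (transport f A). y \<oplus>\<^bsub>transport f A\<^esub> x = \<zero>\<^bsub>transport f A\<^esub>"
      using u by (intro bexI[of _ "f (\<ominus>\<^bsub>A\<^esub> u)"]) (auto simp: simps M.l_neg)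
  qed (auto simp: simps M.a_ac)
  have "Module.module F2 (transport f A)"
    by (rule Module.moduleI[OF R.is_cring grp])
      (auto simp: simps smult_l_distr smult_r_distr smult_assoc1)
  moreover have "associative_algebra_axioms F2 (transport f A)"
    by unfold_locales
      (auto simp: simps mult_closed mult_assoc mult_l_distr mult_r_distr
        smult_mult_left smult_mult_right)
  ultimately show ?thesis
    using A by (simp add: finite_F2_algebra_def associative_algebra_def simps)
qed

lemma monoid_transport:
  assumes "monoid A" and f: "inj_on f (carrier A)"
  shows "monoid (transport f A)"
proof -
  interpret monoid A by fact
  show ?thesis
    by (rule monoidI) (auto simp: transport_def Let_def inv_into_f_f[OF f] m_assoc)
qed

lemma image_ratio_transport:
  assumes A: "finite_F2_algebra A" and f: "inj_on f (carrier A)"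
  shows "image_ratio M (transport f A) = image_ratio M A"
proof -
  interpret associative_algebra F2 A
    using A by (simp add: finite_F2_algebra_def)
  note simps = transport_def Let_def inv_into_f_f[OF f]
  have pow: "((\<lambda>z. z \<otimes>\<^bsub>A\<^esub> u) ^^ k) u \<in> carrier A \<and>
      ((\<lambda>z. z \<otimes>\<^bsub>transport f A\<^esub> f u) ^^ k) (f u) = f (((\<lambda>z. z \<otimes>\<^bsub>A\<^esub> u) ^^ k) u)"
    if "u \<in> carrier A" for u k
    using that by (induction k) (auto simp: simps mult_closed)
  have "(\<lambda>y. positive_pow (transport f A) y M) ` carrier (transport f A)
      = (\<lambda>u. positive_pow (transport f A) (f u) M) ` carrier A"
    by (simp add: simps image_image)
  also have "\<dots> = (\<lambda>u. f (positive_pow A u M)) ` carrier A"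
    using pow by (intro image_cong) (auto simp: positive_pow_def)
  also have "\<dots> = f ` (\<lambda>u. positive_pow A u M) ` carrier A"
    by (simp add: image_image)
  finally have img: "(\<lambda>y. positive_pow (transport f A) y M) ` carrier (transport f A)
      = f ` (\<lambda>u. positive_pow A u M) ` carrier A" .
  have "(\<lambda>u. positive_pow A u M) ` carrier A \<subseteq> carrier A"
    using pow by (auto simp: positive_pow_def)
  then have "card (f ` (\<lambda>u. positive_pow A u M) ` carrier A)
      = card ((\<lambda>u. positive_pow A u M) ` carrier A)"
    using f by (intro card_image) (rule inj_on_subset)
  then show ?thesis
    unfolding image_ratio_def img by (simp add: simps card_image[OF f])
qed

lemma image_ratio_in_image_ratios:
  assumes A: "finite_F2_algebra A"
  shows "image_ratio M A \<in> image_ratios M"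
proof -
  obtain f :: "_ \<Rightarrow> nat" where f: "inj_on f (carrier A)"
    using A finite_imp_inj_to_nat_seg[of "carrier A"] by (auto simp: finite_F2_algebra_def)
  show ?thesis
    using finite_F2_algebra_transport[OF A f] image_ratio_transport[OF A f, of M]
    unfolding image_ratios_def by (auto intro!: exI[of _ "transport f A"])
qed

lemma image_ratio_in_unital_image_ratios:
  assumes A: "finite_F2_algebra A" "monoid A"
  shows "image_ratio M A \<in> unital_image_ratios M"
proof -
  obtain f :: "_ \<Rightarrow> nat" where f: "inj_on f (carrier A)"
    using A finite_imp_inj_to_nat_seg[of "carrier A"] by (auto simp: finite_F2_algebra_def)
  show ?thesis
    using finite_F2_algebra_transport[OF A(1) f] image_ratio_transport[OF A(1) f, of M]
      monoid_transport[OF A(2) f]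
    unfolding unital_image_ratios_def by (auto intro!: exI[of _ "transport f A"])
qed

end

theory Submission
  imports Defs "HOL-Algebra.Algebraic_Closure_Type" "HOL-Library.Z2"
    "HOL-Analysis.Elementary_Metric_Spaces"
begin

text \<open>
  The image ratios of unital algebras form a multiplicative submonoid of \<open>[0, 1]\<close>, because the
  image of a power map on a direct product is the product of the images. If \<open>r < 1\<close> is a member,
  then so are the powers \<open>1, r, r\<^sup>2, \<dots>\<close>, which descend to \<open>0\<close> in steps of length at most
  \<open>1 - r\<close>. So it is enough to find image ratios that are less than \<open>1\<close> but arbitrarily close
  to it (\<open>closure_multiplicative_subset_of_unit_interval\<close>).

  Such ratios come from the algebra of upper triangular \<open>2 \<times> 2\<close> matrices over a field with
  \<open>q = 2 ^ k\<close> elements. Let \<open>(u, b, v)\<close> be the matrix with diagonal \<open>u, v\<close> and corner \<open>b\<close>.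
  In characteristic two,
  \<open>(u, b, v) ^ (2 ^ n) = (u ^ (2 ^ n), b * (u + v) ^ (2 ^ n - 1), v ^ (2 ^ n))\<close>.
  If \<open>u \<noteq> v\<close>, then the factor \<open>u + v\<close> is nonzero and, Frobenius being bijective, nothing is lost;
  if \<open>u = v\<close>, then the corner is killed. Hence the matrices that are missed are exactly the
  \<open>(u, b, u)\<close> with \<open>b \<noteq> 0\<close>. There are \<open>q * (q - 1)\<close> of them among \<open>q\<^sup>3\<close>, and the image ratio
  is \<open>1 - (q - 1) / q\<^sup>2\<close> (\<open>image_ratio_triangular\<close>), which tends to \<open>1\<close> as \<open>k\<close> grows.
\<close>

section \<open>Direct products\<close>

definition prod_algebra ::
    "(int, 'b) module \<Rightarrow> (int, 'c) module \<Rightarrow> (int, 'b \<times> 'c) module" where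
  "prod_algebra A B =
     \<lparr>carrier = carrier A \<times> carrier B,
      monoid.mult = (\<lambda>x y. (fst x \<otimes>\<^bsub>A\<^esub> fst y, snd x \<otimes>\<^bsub>B\<^esub> snd y)),
      one = (\<one>\<^bsub>A\<^esub>, \<one>\<^bsub>B\<^esub>),
      zero = (\<zero>\<^bsub>A\<^esub>, \<zero>\<^bsub>B\<^esub>),
      add = (\<lambda>x y. (fst x \<oplus>\<^bsub>A\<^esub> fst y, snd x \<oplus>\<^bsub>B\<^esub> snd y)),
      module.smult = (\<lambda>c x. (c \<odot>\<^bsub>A\<^esub> fst x, c \<odot>\<^bsub>B\<^esub> snd x))\<rparr>"

lemma finite_F2_algebra_prod:
  assumes A: "finite_F2_algebra A" and B: "finite_F2_algebra B"
  shows "finite_F2_algebra (prod_algebra A B)"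
proof -
  interpret A: associative_algebra F2 A
    using A by (simp add: finite_F2_algebra_def)
  interpret B: associative_algebra F2 B
    using B by (simp add: finite_F2_algebra_def)
  have grp: "abelian_group (prod_algebra A B)"
  proof (rule abelian_groupI)
    fix x assume "x \<in> carrier (prod_algebra A B)"
    then show "\<exists>y\<in>carrier (prod_algebra A B).
        y \<oplus>\<^bsub>prod_algebra A B\<^esub> x = \<zero>\<^bsub>prod_algebra A B\<^esub>"
      by (intro bexI[of _ "(\<ominus>\<^bsub>A\<^esub> fst x, \<ominus>\<^bsub>B\<^esub> snd x)"])
        (auto simp: prod_algebra_def A.M.l_neg B.M.l_neg)
  qed (auto simp: prod_algebra_def A.M.a_ac B.M.a_ac)
  have "Module.module F2 (prod_algebra A B)"
    by (rule Module.moduleI[OF A.R.is_cring grp])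
      (auto simp: prod_algebra_def A.smult_l_distr A.smult_r_distr A.smult_assoc1
        B.smult_l_distr B.smult_r_distr B.smult_assoc1)
  moreover have "associative_algebra_axioms F2 (prod_algebra A B)"
    by unfold_locales
      (auto simp: prod_algebra_def A.mult_closed A.mult_assoc A.mult_l_distr A.mult_r_distr
        A.smult_mult_left A.smult_mult_right B.mult_closed B.mult_assoc B.mult_l_distr
        B.mult_r_distr B.smult_mult_left B.smult_mult_right)
  ultimately show ?thesis
    using A B by (simp add: finite_F2_algebra_def associative_algebra_def prod_algebra_def)
qed

lemma monoid_prod_algebra:
  assumes "monoid A" "monoid B"
  shows "monoid (prod_algebra A B)"
proof -
  interpret A: monoid A by fact
  interpret B: monoid B by fact
  show ?thesis
    by (rule monoidI) (auto simp: prod_algebra_def A.m_assoc B.m_assoc)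
qed

lemma image_ratio_prod_algebra:
  "image_ratio M (prod_algebra A B) = image_ratio M A * image_ratio M B"
proof -
  have pow: "((\<lambda>z. z \<otimes>\<^bsub>prod_algebra A B\<^esub> y) ^^ k) y =
      (((\<lambda>z. z \<otimes>\<^bsub>A\<^esub> fst y) ^^ k) (fst y), ((\<lambda>z. z \<otimes>\<^bsub>B\<^esub> snd y) ^^ k) (snd y))" for y k
    by (induction k) (auto simp: prod_algebra_def)
  have "(\<lambda>y. positive_pow (prod_algebra A B) y M) ` carrier (prod_algebra A B) =
      ((\<lambda>y. positive_pow A y M) ` carrier A) \<times> ((\<lambda>y. positive_pow B y M) ` carrier B)"
    unfolding positive_pow_def pow by (force simp: prod_algebra_def)
  then show ?thesis
    by (simp add: image_ratio_def card_cartesian_product prod_algebra_def)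
qed

lemma unital_image_ratios_mult:
  assumes "r \<in> unital_image_ratios M" "s \<in> unital_image_ratios M"
  shows "r * s \<in> unital_image_ratios M"
proof -
  obtain A B :: "(int, nat) module"
    where AB: "finite_F2_algebra A" "monoid A" "finite_F2_algebra B" "monoid B"
    and rs: "r = image_ratio M A" "s = image_ratio M B"
    using assms by (auto simp: unital_image_ratios_def)
  from AB have "image_ratio M (prod_algebra A B) \<in> unital_image_ratios M"
    by (intro image_ratio_in_unital_image_ratios finite_F2_algebra_prod monoid_prod_algebra)
  then show ?thesis
    by (simp add: rs image_ratio_prod_algebra)
qed

lemma cring_F2: "cring F2"
  using residues.cring[of 2] by (simp add: residues_def)

text \<open>The witness is the zero algebra, where the unit and zero coincide.\<close>

lemma one_in_unital_image_ratios: "1 \<in> unital_image_ratios M"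
proof -
  define Z :: "(int, unit) module" where
    "Z = \<lparr>carrier = UNIV, monoid.mult = \<lambda>_ _. (), one = (), zero = (), add = \<lambda>_ _. (),
      module.smult = \<lambda>_ _. ()\<rparr>"
  have "abelian_group Z"
    by (rule abelian_groupI) (auto simp: Z_def)
  then have "Module.module F2 Z"
    by (intro Module.moduleI cring_F2) (auto simp: Z_def)
  then have "finite_F2_algebra Z"
    by (auto simp: finite_F2_algebra_def associative_algebra_def associative_algebra_axioms_def Z_def)
  moreover have "monoid Z"
    by (rule monoidI) (auto simp: Z_def)
  moreover have "image_ratio M Z = 1"
    by (simp add: image_ratio_def Z_def UNIV_unit)
  ultimately show ?thesis
    using image_ratio_in_unital_image_ratios[of Z M] by simp
qed

section \<open>Triangular matrices over a finite domain of characteristic two\<close>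

text \<open>
  Being a finite domain, \<open>K\<close> is a field; closure under negation and inverses is automatic, by
  \<open>- x = x\<close> and by finiteness. The carrier is a subset of a type because finite fields of unbounded
  size are wanted, all living in one algebraic closure.
\<close>

locale finite_char_2_domain =
  fixes K :: "'k :: idom set"
  assumes char_2: "CHAR('k) = 2"
    and finite_K: "finite K"
    and zero_K: "0 \<in> K"
    and one_K: "1 \<in> K"
    and add_K: "\<lbrakk>x \<in> K; y \<in> K\<rbrakk> \<Longrightarrow> x + y \<in> K"
    and mult_K: "\<lbrakk>x \<in> K; y \<in> K\<rbrakk> \<Longrightarrow> x * y \<in> K"
begin

text \<open>The triple \<open>(u, b, v)\<close> is the upper triangular matrix with rows \<open>(u, b)\<close> and \<open>(0, v)\<close>.\<close>

definition triangular :: "(int, 'k \<times> 'k \<times> 'k) module" where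
  "triangular =
     \<lparr>carrier = K \<times> K \<times> K,
      monoid.mult = (\<lambda>(u, b, v) (u', b', v'). (u * u', u * b' + b * v', v * v')),
      one = (1, 0, 1),
      zero = (0, 0, 0),
      add = (\<lambda>(u, b, v) (u', b', v'). (u + u', b + b', v + v')),
      module.smult = (\<lambda>c x. if c = 0 then (0, 0, 0) else x)\<rparr>"

lemma add_self: "x + x = (0 :: 'k)"
  using uminus_CHAR_2[OF char_2, of x] by (metis add.right_inverse)

lemma add_eq_0_iff_eq: "x + y = 0 \<longleftrightarrow> x = (y :: 'k)"
  using uminus_CHAR_2[OF char_2] by (metis add_eq_0_iff)

lemma add_power_2_power: "(x + y) ^ (2 ^ n) = x ^ (2 ^ n) + (y :: 'k) ^ (2 ^ n)"
  using freshmans_dream'[of "2 ^ n" n x y] char_2 by simp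

lemma power_2_power_eq_iff: "x ^ (2 ^ n) = y ^ (2 ^ n) \<longleftrightarrow> x = (y :: 'k)"
  using add_power_2_power[of x y n] by (metis add_eq_0_iff_eq pos2 power_eq_0_iff zero_less_power)

lemma power_K: "x \<in> K \<Longrightarrow> x ^ n \<in> K"
  by (induction n) (auto intro: one_K mult_K)

lemma finite_F2_algebra_triangular: "finite_F2_algebra triangular"
proof -
  have carrier_F2: "carrier F2 = {0, 1}"
    by (auto simp: residue_ring_def)
  have ops_F2: "\<one>\<^bsub>F2\<^esub> = 1" "x \<oplus>\<^bsub>F2\<^esub> y = (x + y) mod 2"
    "x \<otimes>\<^bsub>F2\<^esub> y = (x * y) mod 2" for x y
    by (simp_all add: residue_ring_def)
  have grp: "abelian_group triangular"
  proof (rule abelian_groupI)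
    fix x assume "x \<in> carrier triangular"
    then show "\<exists>y\<in>carrier triangular. y \<oplus>\<^bsub>triangular\<^esub> x = \<zero>\<^bsub>triangular\<^esub>"
      by (intro bexI[of _ x]) (auto simp: triangular_def add_self)
  qed (auto simp: triangular_def zero_K add_K algebra_simps)
  have "Module.module F2 triangular"
    by (rule Module.moduleI[OF cring_F2 grp])
      (auto simp: carrier_F2 ops_F2 triangular_def zero_K add_self)
  moreover have "associative_algebra_axioms F2 triangular"
    by unfold_locales
      (auto simp: carrier_F2 triangular_def zero_K add_K mult_K algebra_simps)
  ultimately show ?thesis
    using finite_K by (simp add: finite_F2_algebra_def associative_algebra_def triangular_def)
qed

lemma monoid_triangular: "monoid triangular"
  by (rule monoidI) (auto simp: triangular_def zero_K one_K add_K mult_K algebra_simps)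

text \<open>
  The corner of the square of \<open>(U, B, V)\<close> is \<open>B * (U + V)\<close>. After \<open>n\<close> squarings
  \<open>U + V = u ^ (2 ^ n) + v ^ (2 ^ n) = (u + v) ^ (2 ^ n)\<close>, so the exponents of \<open>u + v\<close> collected
  in the corner add up to \<open>1 + 2 + 4 + \<dots> + 2 ^ (n - 1) = 2 ^ n - 1\<close>.
\<close>

lemma positive_pow_triangular:
  assumes "(u, b, v) \<in> carrier triangular"
  shows "positive_pow triangular (u, b, v) (2 ^ n) =
    (u ^ (2 ^ n), b * (u + v) ^ (2 ^ n - 1), v ^ (2 ^ n))"
proof -
  interpret monoid triangular by (rule monoid_triangular)
  have "(u, b, v) [^]\<^bsub>triangular\<^esub> ((2 :: nat) ^ n) =
    (u ^ (2 ^ n), b * (u + v) ^ (2 ^ n - 1), v ^ (2 ^ n))"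
  proof (induction n)
    case 0
    then show ?case
      using assms by simp
  next
    case (Suc n)
    have exp: "2 ^ n + (2 ^ n - 1) = 2 * 2 ^ n - (1 :: nat)"
      by simp
    have "(u, b, v) [^]\<^bsub>triangular\<^esub> ((2 :: nat) ^ Suc n) =
        (u, b, v) [^]\<^bsub>triangular\<^esub> ((2 :: nat) ^ n) \<otimes>\<^bsub>triangular\<^esub>
        (u, b, v) [^]\<^bsub>triangular\<^esub> ((2 :: nat) ^ n)"
      using nat_pow_mult[OF assms, of "2 ^ n" "2 ^ n"] by (simp add: mult_2)
    also have "\<dots> = (u ^ (2 * 2 ^ n),
        b * ((u ^ 2 ^ n + v ^ 2 ^ n) * (u + v) ^ (2 ^ n - 1)), v ^ (2 * 2 ^ n))"
      unfolding Suc by (simp add: triangular_def mult_2 power_add algebra_simps)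
    also have "(u ^ 2 ^ n + v ^ 2 ^ n) * (u + v) ^ (2 ^ n - 1) = (u + v) ^ (2 * 2 ^ n - 1)"
      unfolding exp[symmetric] power_add by (simp add: add_power_2_power)
    finally show ?case
      by simp
  qed
  then show ?thesis
    using positive_pow_eq_nat_pow[OF assms, of "2 ^ n"] by simp
qed

text \<open>
  The exponent \<open>2 ^ n - 1\<close> is positive, so the power map sends every matrix into the set on the
  right. On that finite set the map is injective: the diagonal is determined by injectivity of
  Frobenius, and the corner is either \<open>0\<close> or multiplied by a nonzero element. An injective map of
  a finite set to itself is onto.
\<close>

lemma image_positive_pow_triangular:
  assumes "n \<ge> 1"
  shows "(\<lambda>y. positive_pow triangular y (2 ^ n)) ` carrier triangular =
    {(u, b, v) \<in> K \<times> K \<times> K. u = v \<longrightarrow> b = 0}" (is "?p ` _ = ?S")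
proof
  have pos: "2 ^ n - (1 :: nat) > 0"
    using assms one_less_power[of "2 :: nat" n] by simp
  have carrier: "carrier triangular = K \<times> K \<times> K"
    by (simp add: triangular_def)
  have p: "?p (u, b, v) = (u ^ (2 ^ n), b * (u + v) ^ (2 ^ n - 1), v ^ (2 ^ n))"
    if "u \<in> K" "b \<in> K" "v \<in> K" for u b v
    using that by (intro positive_pow_triangular) (simp add: carrier)
  show image: "?p ` carrier triangular \<subseteq> ?S"
    using pos by (auto simp: carrier p power_K add_K mult_K power_2_power_eq_iff add_self)
  have S: "?S \<subseteq> carrier triangular"
    by (auto simp: triangular_def)
  have "inj_on ?p ?S"
    by (intro inj_onI) (auto simp: p power_2_power_eq_iff add_eq_0_iff_eq)
  moreover have "finite ?S"
    using finite_K by (intro finite_subset[of ?S "K \<times> K \<times> K"]) auto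
  ultimately have "?p ` ?S = ?S"
    using subset_trans[OF image_mono[OF S] image] by (intro endo_inj_surj)
  then show "?S \<subseteq> ?p ` carrier triangular"
    using S by blast
qed

lemma image_ratio_triangular:
  assumes "n \<ge> 1"
  shows "image_ratio (2 ^ n) triangular = 1 - (real (card K) - 1) / real (card K) ^ 2"
proof -
  define q where "q = card K"
  have q: "q > 0"
    using finite_K zero_K by (auto simp: q_def card_gt_0_iff)
  \<comment> \<open>the matrices outside the image, with equal diagonal entries and a nonzero corner\<close>
  define N where "N = (\<lambda>(u, b). (u, b, u)) ` (K \<times> (K - {0}))"
  have "inj_on (\<lambda>(u, b). (u, b, u)) (K \<times> (K - {0}))"
    by (auto simp: inj_on_def)
  then have N: "card N = q * (q - 1)"
    using finite_K zero_K by (simp add: N_def card_image card_cartesian_product q_def)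
  have K3: "card (K \<times> K \<times> K) = q ^ 3"
    by (simp add: card_cartesian_product q_def power3_eq_cube)
  have sub: "N \<subseteq> K \<times> K \<times> K"
    by (auto simp: N_def)
  have "(\<lambda>y. positive_pow triangular y (2 ^ n)) ` carrier triangular = K \<times> K \<times> K - N"
    unfolding image_positive_pow_triangular[OF assms] by (auto simp: N_def image_iff)
  moreover have "real (card (K \<times> K \<times> K - N)) = real q ^ 3 - real q * (real q - 1)"
    using finite_K sub q card_mono[OF _ sub]
    by (simp add: card_Diff_subset finite_subset[OF sub] N K3 of_nat_diff)
  ultimately have "real (card ((\<lambda>y. positive_pow triangular y (2 ^ n)) ` carrier triangular))
      = real q ^ 3 - real q * (real q - 1)"
    by simp
  moreover have "real (card (carrier triangular)) = real q ^ 3"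
    by (simp add: triangular_def card_cartesian_product q_def power3_eq_cube)
  ultimately show ?thesis
    using q unfolding image_ratio_def q_def[symmetric]
    by (simp add: field_simps power2_eq_square power3_eq_cube)
qed

end

section \<open>Finite fields of characteristic two\<close>

text \<open>For \<open>k \<ge> 1\<close> this is the subfield with \<open>2 ^ k\<close> elements.\<close>

definition frobenius_fixed :: "nat \<Rightarrow> bit alg_closure set" where
  "frobenius_fixed k = {x. x ^ (2 ^ k) = x}"

lemma CHAR_bit: "CHAR(bit) = 2"
proof (rule CHAR_eq_posI)
  fix n :: nat assume "0 < n" "n < 2"
  then have "n = 1" by simp
  then show "of_nat n \<noteq> (0 :: bit)" by simp
qed auto

text \<open>
  The set consists of the roots of \<open>X ^ (2 ^ k) - X\<close>. This polynomial splits into linear factors,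
  and they are distinct because its derivative is the constant \<open>-1\<close>.
\<close>

lemma card_frobenius_fixed:
  assumes "k \<ge> 1"
  shows "card (frobenius_fixed k) = 2 ^ k"
proof -
  define p :: "bit alg_closure poly" where "p = monom 1 (2 ^ k) - monom 1 1"
  have q: "(2 :: nat) ^ k > 1"
    using assms one_less_power[of "2 :: nat" k] by simp
  have deg: "degree p = 2 ^ k"
    unfolding p_def using q by (subst diff_conv_add_uminus, subst degree_add_eq_left)
      (auto simp: degree_monom_eq)
  then have "p \<noteq> 0"
    by auto
  then obtain A where A: "size A = degree p" "p = smult (lead_coeff p) (\<Prod>x\<in>#A. [:-x, 1:])"
    using alg_closed_imp_factorization by blast
  have two: "of_nat (2 ^ k) = (0 :: bit alg_closure)"
    using assms by (simp only: of_nat_eq_0_iff_char_dvd CHAR_alg_closure CHAR_bit) auto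
  have pderiv: "pderiv p = [:-1:]"
    unfolding p_def by (simp only: pderiv_diff pderiv_monom two)
      (simp add: monom_0)
  have roots: "poly p x = 0 \<longleftrightarrow> x \<in> frobenius_fixed k" for x
    by (simp add: p_def frobenius_fixed_def poly_monom)
  have "poly p x = 0 \<longleftrightarrow> x \<in># A" for x
    using \<open>p \<noteq> 0\<close> by (subst A(2)) (auto simp: poly_prod_mset prod_mset_zero_iff)
  then have set_A: "set_mset A = frobenius_fixed k"
    using roots by auto
  \<comment> \<open>a repeated linear factor would be shared with the derivative\<close>
  have "count A x \<le> 1" for x
  proof (rule ccontr)
    assume "\<not> count A x \<le> 1"
    then have "{#x, x#} \<subseteq># A"
      by (auto simp: subseteq_mset_def)
    then obtain B where "A = {#x, x#} + B"
      by (auto simp: subset_mset.le_iff_add)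
    with A(2) have "p = smult (lead_coeff p) ([:-x, 1:] * ([:-x, 1:] * (\<Prod>y\<in>#B. [:-y, 1:])))"
      by simp
    then have "p = [:-x, 1:] * ([:-x, 1:] * smult (lead_coeff p) (\<Prod>y\<in>#B. [:-y, 1:]))"
      by (simp only: mult_smult_right)
    then obtain r where r: "p = [:-x, 1:] * ([:-x, 1:] * r)"
      by blast
    have "poly (pderiv p) x = 0"
      by (subst r, simp only: pderiv_mult poly_add poly_mult) simp
    then show False
      by (simp add: pderiv)
  qed
  then have "count A x = (if x \<in># A then 1 else 0)" for x
    by (simp add: le_antisym Suc_le_eq not_in_iff)
  then have "A = mset_set (frobenius_fixed k)"
    unfolding set_A[symmetric] by (intro multiset_eqI) simp
  then show ?thesis
    using A(1) deg by simp
qed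

lemma finite_char_2_domain_frobenius_fixed:
  assumes "k \<ge> 1"
  shows "finite_char_2_domain (frobenius_fixed k)"
proof
  show "finite (frobenius_fixed k)"
    using card_frobenius_fixed[OF assms] by (intro card_ge_0_finite) simp
  show "x + y \<in> frobenius_fixed k" if "x \<in> frobenius_fixed k" "y \<in> frobenius_fixed k" for x y
    using that freshmans_dream'[of "2 ^ k" k x y]
    by (simp add: frobenius_fixed_def CHAR_bit)
qed (auto simp: frobenius_fixed_def CHAR_bit power_mult_distrib)

section \<open>Density\<close>

text \<open>
  Given \<open>x > 0\<close> and \<open>r \<in> S\<close> with \<open>1 - e < r < 1\<close>, take the first power \<open>r ^ n \<le> x\<close>. If
  \<open>n = 0\<close>, then \<open>x = 1\<close>; otherwise the preceding power exceeds \<open>x\<close> and differs from \<open>r ^ n\<close> by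
  at most \<open>1 - r < e\<close>. The point \<open>0\<close>
  is a limit of positive ones.
\<close>

lemma closure_multiplicative_subset_of_unit_interval:
  fixes S :: "real set"
  assumes S: "S \<subseteq> {0..1}" and one: "1 \<in> S"
    and mult: "\<And>r s. \<lbrakk>r \<in> S; s \<in> S\<rbrakk> \<Longrightarrow> r * s \<in> S"
    and near_1: "\<And>e. e > 0 \<Longrightarrow> \<exists>r\<in>S. 1 - e < r \<and> r < 1"
  shows "closure S = {0..1}"
proof
  show "closure S \<subseteq> {0..1}"
    using S by (intro closure_minimal) auto
  have "x \<in> closure S" if x: "x \<in> {0<..1}" for x
    unfolding closure_approachable
  proof (intro allI impI)
    fix e :: real assume "e > 0"
    then obtain r where r: "r \<in> S" "1 - e < r" "r < 1"
      using near_1 by blast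
    have r0: "r \<ge> 0"
      using r S by auto
    have pow: "r ^ n \<in> S" for n
      by (induction n) (auto intro: one mult r)
    define n where "n = (LEAST n. r ^ n \<le> x)"
    have "\<exists>n. r ^ n \<le> x"
      using real_arch_pow_inv[of x r] x r by (auto intro: less_imp_le)
    then have n: "r ^ n \<le> x"
      unfolding n_def by (rule LeastI_ex)
    have "x < r ^ n + e"
    proof (cases n)
      case 0
      then show ?thesis
        using x \<open>e > 0\<close> by simp
    next
      case (Suc m)
      then have "x < r ^ m"
        using not_less_Least[of m "\<lambda>n. r ^ n \<le> x"] by (simp add: n_def not_le)
      moreover have "r ^ m * (1 - r) \<le> 1 * (1 - r)"
        using r r0 by (intro mult_right_mono power_le_one) auto
      ultimately show ?thesis
        using Suc r by (simp add: algebra_simps)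
    qed
    with n show "\<exists>y\<in>S. dist y x < e"
      using pow by (intro bexI[of _ "r ^ n"]) (auto simp: dist_real_def)
  qed
  then have "closure {0<..1::real} \<subseteq> closure S"
    by (intro closure_minimal) auto
  then show "{0..1} \<subseteq> closure S"
    by simp
qed

lemma image_ratio_le_1: "finite (carrier A) \<Longrightarrow> image_ratio M A \<le> 1"
  by (cases "carrier A = {}") (simp_all add: image_ratio_def card_image_le divide_le_eq_1 card_gt_0_iff)

lemma unital_image_ratio_near_1:
  fixes e :: real
  assumes "n \<ge> 1" "e > 0"
  shows "\<exists>r\<in>unital_image_ratios (2 ^ n). 1 - e < r \<and> r < 1"
proof -
  obtain k where "(1 / 2) ^ k < e"
    using real_arch_pow_inv[of e "1 / 2"] assms by auto
  \<comment> \<open>the exponent is \<open>Suc k\<close> so that it is positive and the field has more than one element\<close>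
  moreover define q :: real where "q = 2 ^ Suc k"
  ultimately have q: "q > 1" "1 / q < e"
    using one_less_power[of "2 :: real" "Suc k"] zero_less_power[of "2 :: real" k]
    by (auto simp: power_one_over field_simps)
  interpret finite_char_2_domain "frobenius_fixed (Suc k)"
    by (rule finite_char_2_domain_frobenius_fixed) simp
  have "image_ratio (2 ^ n) triangular = 1 - (q - 1) / q ^ 2"
    using image_ratio_triangular[OF assms(1)] card_frobenius_fixed[of "Suc k"]
    by (simp add: q_def)
  moreover have "(q - 1) / q ^ 2 > 0"
    using q by simp
  moreover have "(q - 1) / q ^ 2 < 1 / q"
    using q by (simp add: field_simps power2_eq_square)
  moreover have "image_ratio (2 ^ n) triangular \<in> unital_image_ratios (2 ^ n)"
    by (intro image_ratio_in_unital_image_ratios finite_F2_algebra_triangular monoid_triangular)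
  ultimately show ?thesis
    using q by (intro bexI[of _ "image_ratio (2 ^ n) triangular"]) auto
qed

theorem theorem3p1:
  fixes a M :: nat
  assumes "a \<ge> 2" and "M = 2 ^ a"
  shows "closure (image_ratios M) = {0..1} \<and> closure (unital_image_ratios M) = {0..1}"
proof -
  have all: "image_ratios M \<subseteq> {0..1}"
    by (auto simp: image_ratios_def finite_F2_algebra_def image_ratio_le_1)
      (simp add: image_ratio_def)
  have sub: "unital_image_ratios M \<subseteq> image_ratios M"
    by (auto simp: unital_image_ratios_def image_ratios_def)
  have unital: "closure (unital_image_ratios M) = {0..1}"
  proof (rule closure_multiplicative_subset_of_unit_interval)
    show "unital_image_ratios M \<subseteq> {0..1}"
      using sub all by blast
    show "\<exists>r\<in>unital_image_ratios M. 1 - e < r \<and> r < 1" if "e > 0" for e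
      using unital_image_ratio_near_1[of a e] that assms by simp
  qed (auto intro: one_in_unital_image_ratios unital_image_ratios_mult)
  moreover have "closure (image_ratios M) = {0..1}"
  proof
    show "closure (image_ratios M) \<subseteq> {0..1}"
      using all by (intro closure_minimal) auto
    show "{0..1} \<subseteq> closure (image_ratios M)"
      using closure_mono[OF sub] unital by simp
  qed
  ultimately show ?thesis
    by simp
qed

end
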